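(* Assume that $f$ is $\mu_f$-strongly convex and $h$ is $L_h$-smooth, with $\mu_f>0$ and $0<L_h<+\infty$. Let $x^\star$ be the (unique) minimizer of $P(x)=f(x)+g(x)+h(x)$ and $u^\star$ the (unique) minimizer of $D(u)=(f+g)^*(-u)+h^*(u)$. Define $$\rho=\mu_f\min\{\gamma_0,\tau/L_f\},\qquad \sigma=\frac{1}{1+\gamma_0L_h},\qquad \xi=\frac{\mu_f}{\mu_f+L_h}.$$ Let $x_{t+1},u_{t+1}$ be the iterates produced by the Adaptive Three Operator Splitting algorithm at iteration $t\ge 0$. Then: (V1) for Variant 1, $\displaystyle \|x_{t+1}-x^\star\|^2\le\big(1-\min\{\rho,\sigma\}\big)^{t+1}D_0$; (V2) for Variant 2 (with $h$ also $\beta_h$-Lipschitz), $\displaystyle \|x_{t+1}-x^\star\|^2\le\big(1-\min\{\rho,\xi,\tfrac12\}\big)^{t+1}E_0$; where $D_0=6\|z_0-x^\star\|^2+\frac{6}{1-\sigma}\|\gamma_0(u_0-u^\star)\|^2$ and $E_0=6\|z_0-x^\star\|^2+\frac{6}{1-\xi}\|\gamma_0(u_0-u^\star)\|^2$.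
   Context: Standing assumptions: $f:\mathbb{R}^p\to\mathbb{R}$ is convex and $L_f$-smooth (differentiable with $L_f$-Lipschitz gradient, $L_f>0$); $g,h:\mathbb{R}^p\to\,]-\infty,+\infty]$ are proper, lower semicontinuous and convex; the relative interiors of $\operatorname{dom} g$ and $\operatorname{dom} h$ have non-empty intersection. Notation: $\operatorname{prox}_{\gamma\varphi}(x)=\arg\min_{z\in\mathbb{R}^p}\{\varphi(z)+\frac{1}{2\gamma}\|x-z\|^2\}$; $\varphi^*$ is the Fenchel conjugate of $\varphi$; $\|\cdot\|$ is the Euclidean norm. "$L_h$-smooth" means differentiable with $L_h$-Lipschitz gradient. Adaptive Three Operator Splitting algorithm. Input: $z_0,u_0\in\mathbb{R}^p$, an initial step-size $\gamma_0>0$, $\tau\in(0,1)$. For $t=0,1,2,\dots$: (1) Step-size search loop: compute $x_{t+1}=\operatorname{prox}_{\gamma_t g}(z_t-\gamma_t u_t-\gamma_t\nabla f(z_t))$. If the sufficient decrease condition $f(x_{t+1})\le Q_t(x_{t+1},\gamma_t)$ holds, exit the loop; otherwise replace $\gamma_t$ by $\tau\gamma_t$ and repeat. Here $$Q_t(x,\gamma)=f(z_t)+\langle\nabla f(z_t),x-z_t\rangle+\frac{1}{2\gamma}\|x-z_t\|^2 .$$ (2) Set $z_{t+1}=\operatorname{prox}_{\gamma_t h}(x_{t+1}+\gamma_t u_t)$ and $u_{t+1}=u_t+(x_{t+1}-z_{t+1})/\gamma_t$. (3) Initialize the next step-size. Variant 1: $\gamma_{t+1}=\gamma_t$. Variant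 2 (only allowed if $h$ is $\beta_h$-Lipschitz): with $\delta_t=Q_t(x_{t+1},\gamma_t)-f(x_{t+1})$, choose any $\gamma_{t+1}\in\big[\gamma_t,\sqrt{\gamma_t^2+\gamma_t\delta_t(2\beta_h)^{-2}}\,\big]$. The search loop terminates at every iteration (the condition holds whenever $\gamma_t\le 1/L_f$). In the statement, $\gamma_t$ (including $\gamma_0$) denotes the value at exit of the search loop of iteration $t$. *)

theory Defs
  imports "HOL-Analysis.Analysis"
begin

section \<open>Convex analysis\<close>

text \<open>Functions with values in \<open>]-\<infinity>, +\<infinity>]\<close> are represented as \<^typ>\<open>ereal\<close>-valued functions;
  the value \<open>-\<infinity>\<close> is excluded by \<open>proper_fun\<close>.\<close>

definition edom :: "('a \<Rightarrow> ereal) \<Rightarrow> 'a set" where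
  "edom \<phi> = {x. \<phi> x < \<infinity>}"

definition proper_fun :: "('a \<Rightarrow> ereal) \<Rightarrow> bool" where
  "proper_fun \<phi> \<longleftrightarrow> (\<forall>x. \<phi> x \<noteq> -\<infinity>) \<and> (\<exists>x. \<phi> x \<noteq> \<infinity>)"

definition lsc_fun :: "('a::topological_space \<Rightarrow> ereal) \<Rightarrow> bool" where
  "lsc_fun \<phi> \<longleftrightarrow> (\<forall>x. \<phi> x \<le> Liminf (at x) \<phi>)"

text \<open>The right-hand side is unproblematic for functions that never take the value \<open>-\<infinity>\<close>:
  on \<^typ>\<open>ereal\<close> one has \<open>0 * \<infinity> = 0\<close>, so \<open>s = 0\<close> and \<open>s = 1\<close> give trivial inequalities.\<close>

definition convex_efun :: "('a::real_vector \<Rightarrow> ereal) \<Rightarrow> bool" where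
  "convex_efun \<phi> \<longleftrightarrow>
     (\<forall>x y. \<forall>s\<in>{0..1}. \<phi> ((1 - s) *\<^sub>R x + s *\<^sub>R y) \<le> ereal (1 - s) * \<phi> x + ereal s * \<phi> y)"

definition strongly_convex :: "real \<Rightarrow> ('a::real_inner \<Rightarrow> real) \<Rightarrow> bool" where
  "strongly_convex \<mu> f \<longleftrightarrow> convex_on UNIV (\<lambda>x. f x - \<mu> / 2 * (norm x)\<^sup>2)"

text \<open>Unspecified where \<open>f\<close> is not differentiable.\<close>

definition grad :: "('a::real_inner \<Rightarrow> real) \<Rightarrow> 'a \<Rightarrow> 'a" where
  "grad f x = (THE D. GDERIV f x :> D)"

definition L_smooth :: "real \<Rightarrow> ('a::real_inner \<Rightarrow> real) \<Rightarrow> bool" where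
  "L_smooth L f \<longleftrightarrow> (\<forall>x. f differentiable (at x)) \<and> L-lipschitz_on UNIV (grad f)"

text \<open>Smoothness and Lipschitz continuity of an extended-valued function include that it is
  finite everywhere.\<close>

definition finite_fun :: "('a \<Rightarrow> ereal) \<Rightarrow> bool" where
  "finite_fun \<phi> \<longleftrightarrow> (\<forall>x. \<bar>\<phi> x\<bar> \<noteq> \<infinity>)"

definition L_smooth_efun :: "real \<Rightarrow> ('a::real_inner \<Rightarrow> ereal) \<Rightarrow> bool" where
  "L_smooth_efun L \<phi> \<longleftrightarrow> finite_fun \<phi> \<and> L_smooth L (\<lambda>x. real_of_ereal (\<phi> x))"

definition lipschitz_efun :: "real \<Rightarrow> ('a::metric_space \<Rightarrow> ereal) \<Rightarrow> bool" where
  "lipschitz_efun \<beta> \<phi> \<longleftrightarrow> finite_fun \<phi> \<and> \<beta>-lipschitz_on UNIV (\<lambda>x. real_of_ereal (\<phi> x))"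

definition conjugate :: "('a::real_inner \<Rightarrow> ereal) \<Rightarrow> 'a \<Rightarrow> ereal" where
  "conjugate \<phi> u = (SUP x. ereal (u \<bullet> x) - \<phi> x)"

definition is_minimizer :: "('a \<Rightarrow> ereal) \<Rightarrow> 'a \<Rightarrow> bool" where
  "is_minimizer \<phi> x \<longleftrightarrow> is_arg_min \<phi> (\<lambda>_. True) x"

text \<open>The set of minimizers; it is a singleton for proper, lower semicontinuous, convex
  \<open>\<phi>\<close> and \<open>\<gamma> > 0\<close>.\<close>

definition prox :: "real \<Rightarrow> ('a::real_inner \<Rightarrow> ereal) \<Rightarrow> 'a \<Rightarrow> 'a set" where
  "prox \<gamma> \<phi> x = {z. is_minimizer (\<lambda>z. \<phi> z + ereal (1 / (2 * \<gamma>) * (norm (x - z))\<^sup>2)) z}"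

section \<open>Adaptive three operator splitting\<close>

definition Q_model :: "('a::real_inner \<Rightarrow> real) \<Rightarrow> 'a \<Rightarrow> 'a \<Rightarrow> real \<Rightarrow> real" where
  "Q_model f z x \<gamma> = f z + grad f z \<bullet> (x - z) + 1 / (2 * \<gamma>) * (norm (x - z))\<^sup>2"

text \<open>\<open>step_search f g \<tau> z u \<gamma>in \<gamma> x\<close>: the backtracking loop, entered with step-size \<open>\<gamma>in\<close>
  at the point \<open>(z, u)\<close>, exits with step-size \<open>\<gamma>\<close> and new iterate \<open>x\<close>.\<close>

inductive step_search ::
    "('a::real_inner \<Rightarrow> real) \<Rightarrow> ('a \<Rightarrow> ereal) \<Rightarrow> real \<Rightarrow> 'a \<Rightarrow> 'a \<Rightarrow> real \<Rightarrow> real \<Rightarrow> 'a \<Rightarrow> bool"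
  for f g \<tau> z u where
  accept: "x \<in> prox \<gamma> g (z - \<gamma> *\<^sub>R u - \<gamma> *\<^sub>R grad f z) \<Longrightarrow> f x \<le> Q_model f z x \<gamma>
    \<Longrightarrow> step_search f g \<tau> z u \<gamma> \<gamma> x"
| shrink: "y \<in> prox \<gamma>in g (z - \<gamma>in *\<^sub>R u - \<gamma>in *\<^sub>R grad f z) \<Longrightarrow> \<not> f y \<le> Q_model f z y \<gamma>in
    \<Longrightarrow> step_search f g \<tau> z u (\<tau> * \<gamma>in) \<gamma> x \<Longrightarrow> step_search f g \<tau> z u \<gamma>in \<gamma> x"

text \<open>Rules for initializing the next step-size: \<open>next_step \<gamma> \<delta> \<gamma>'\<close> says that after an iteration
  with exit step-size \<open>\<gamma>\<close> and slack \<open>\<delta>\<close> in the sufficient decrease condition, the next search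
  may start with \<open>\<gamma>'\<close>.\<close>

definition variant1 :: "real \<Rightarrow> real \<Rightarrow> real \<Rightarrow> bool" where
  "variant1 \<gamma> \<delta> \<gamma>' \<longleftrightarrow> \<gamma>' = \<gamma>"

definition variant2 :: "real \<Rightarrow> real \<Rightarrow> real \<Rightarrow> real \<Rightarrow> bool" where
  "variant2 \<beta> \<gamma> \<delta> \<gamma>' \<longleftrightarrow> \<gamma>' \<in> {\<gamma> .. sqrt (\<gamma>\<^sup>2 + \<gamma> * \<delta> * (2 * \<beta>) powi (-2))}"

text \<open>\<open>\<gamma>in t\<close> is the step-size on entering the search loop of iteration \<open>t\<close> (so \<open>\<gamma>in 0\<close> is the
  input of the algorithm), \<open>\<gamma> t\<close> the one on exit. The value \<open>x 0\<close> is irrelevant.\<close>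

definition atos_run ::
    "(real \<Rightarrow> real \<Rightarrow> real \<Rightarrow> bool) \<Rightarrow> ('a::real_inner \<Rightarrow> real) \<Rightarrow> ('a \<Rightarrow> ereal) \<Rightarrow> ('a \<Rightarrow> ereal) \<Rightarrow> real
      \<Rightarrow> (nat \<Rightarrow> real) \<Rightarrow> (nat \<Rightarrow> real) \<Rightarrow> (nat \<Rightarrow> 'a) \<Rightarrow> (nat \<Rightarrow> 'a) \<Rightarrow> (nat \<Rightarrow> 'a) \<Rightarrow> bool" where
  "atos_run next_step f g h \<tau> \<gamma>in \<gamma> x z u \<longleftrightarrow>
     \<gamma>in 0 > 0 \<and>
     (\<forall>t. step_search f g \<tau> (z t) (u t) (\<gamma>in t) (\<gamma> t) (x (Suc t)) \<and>
          z (Suc t) \<in> prox (\<gamma> t) h (x (Suc t) + \<gamma> t *\<^sub>R u t) \<and>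
          u (Suc t) = u t + (1 / \<gamma> t) *\<^sub>R (x (Suc t) - z (Suc t)) \<and>
          next_step (\<gamma> t) (Q_model f (z t) (x (Suc t)) (\<gamma> t) - f (x (Suc t))) (\<gamma>in (Suc t)))"

end

theory Submission
  imports Defs
begin

text \<open>
  Let \<open>a = u\<^sub>t - u\<^sup>\<star>\<close>, \<open>b = u\<^sub>t\<^sub>+\<^sub>1 - u\<^sup>\<star>\<close> and \<open>w = z\<^sub>t\<^sub>+\<^sub>1 - x\<^sup>\<star>\<close>, let \<open>\<delta>\<close> be the slack in the sufficient
  decrease condition, and write \<open>\<mu>\<close> for the strong convexity constant of \<open>f\<close> and \<open>L\<close> for the smoothness
  constant of \<open>h\<close>. Fenchel--Young duality identifies \<open>u\<^sup>\<star>\<close> as the gradient of \<open>h\<close> at \<open>x\<^sup>\<star>\<close>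
  (\<open>dual_minimizer_subgradient\<close>). Combining strong convexity of \<open>f\<close>, the decrease condition,
  monotonicity of the subdifferential of \<open>g\<close> and cocoercivity of the gradient of \<open>h\<close>, one iteration
  satisfies (\<open>energy_decrease\<close>)

  \<open>\<parallel>w\<parallel>\<^sup>2 + (\<gamma>\<^sup>2 + 2 \<gamma> / L) \<parallel>b\<parallel>\<^sup>2 + 2 \<gamma> \<delta> \<le> (1 - \<gamma> \<mu>) \<parallel>z\<^sub>t - x\<^sup>\<star>\<parallel>\<^sup>2 + \<gamma>\<^sup>2 \<parallel>a\<parallel>\<^sup>2\<close>.

  The primal error contracts by strong convexity of \<open>f\<close>, the dual error because of the extra weight
  \<open>2 \<gamma> / L\<close> on the left. Hence \<open>V\<^sub>t = \<parallel>z\<^sub>t - x\<^sup>\<star>\<parallel>\<^sup>2 + c\<^sub>t \<parallel>u\<^sub>t - u\<^sup>\<star>\<parallel>\<^sup>2\<close> decreases linearly for suitable weights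
  \<open>c\<^sub>t\<close>, and \<open>V\<^sub>t\<close> controls the error of \<open>x\<^sub>t\<^sub>+\<^sub>1\<close> (\<open>linear_rate\<close>).

  If the step-size never grows, \<open>c\<^sub>t = \<gamma>\<^sub>t\<^sup>2 + \<gamma>\<^sub>t / L\<close> works (\<open>rate_nonincreasing_steps\<close>). If it may grow, the
  rate must not depend on an upper bound for \<open>\<gamma>\<^sub>t\<close>, and the weight is
  \<open>c\<^sub>t = (1 + \<kappa>) \<gamma>\<^sub>t\<^sup>2\<close> with \<open>\<kappa> = min (\<mu> / L) 1\<close> (\<open>rate_growing_steps\<close>): the slack \<open>\<delta>\<close> pays for the growth
  of the step-size, because the gradients of \<open>h\<close> are bounded, and \<open>2 \<gamma> / L\<close> pays for \<open>\<kappa> \<gamma>\<^sup>2\<close> as long as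
  \<open>\<gamma> \<mu> \<le> 1\<close>. This weight makes a longer step dangerous, but after the first iteration a longer step is accepted
  only at the solution (\<open>stationary_if_large_step\<close>). Since the payment is made at the weight
  of the next iteration, a long first step, with an arbitrary \<open>u\<^sub>0\<close>, does no harm.
\<close>

section \<open>Gradients\<close>

lemma DERIV_along_line:
  fixes q :: "'a::real_inner \<Rightarrow> real"
  assumes "GDERIV q (x + t *\<^sub>R d) :> D"
  shows "((\<lambda>t. q (x + t *\<^sub>R d)) has_real_derivative D \<bullet> d) (at t)"
proof -
  have "((\<lambda>t. x + t *\<^sub>R d) has_derivative (\<lambda>s. s *\<^sub>R d)) (at t)"
    by (auto intro!: derivative_eq_intros)
  from has_derivative_compose[OF this, of q "\<lambda>h. h \<bullet> D"] assms
  have "((\<lambda>t. q (x + t *\<^sub>R d)) has_derivative (\<lambda>s. (s *\<^sub>R d) \<bullet> D)) (at t)"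
    by (simp add: gderiv_def)
  then show ?thesis
    by (simp add: has_field_derivative_def inner_commute mult.commute[of _ "D \<bullet> d"] cong: if_cong)
qed

text \<open>Every first-order condition below (tangent inequalities, optimality conditions, uniqueness of
  subgradients, the gradient bound for Lipschitz functions) is an upper bound on a forward
  difference quotient, passed to the limit by this lemma.\<close>

lemma gradient_le_if_forward_difference_le:
  fixes q :: "'a::real_inner \<Rightarrow> real"
  assumes grad: "GDERIV q x :> D"
    and le: "\<And>s. 0 < s \<Longrightarrow> s < 1 \<Longrightarrow> q (x + s *\<^sub>R d) - q x \<le> s * c"
  shows "D \<bullet> d \<le> c"
proof -
  have "((\<lambda>s. q (x + s *\<^sub>R d)) has_real_derivative D \<bullet> d) (at 0)"
    using grad by (intro DERIV_along_line) simp
  then have "((\<lambda>s. (q (x + s *\<^sub>R d) - q x) / s) \<longlongrightarrow> D \<bullet> d) (at_right 0)"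
    by (auto simp: has_field_derivative_iff intro: filterlim_mono[OF _ order.refl at_le])
  moreover have "\<forall>\<^sub>F s in at_right 0. (q (x + s *\<^sub>R d) - q x) / s \<le> c"
    unfolding eventually_at_right_field
    by (intro exI[of _ 1]) (auto simp: divide_le_eq le mult.commute[of c])
  ultimately show ?thesis
    by (rule tendsto_upperbound) simp
qed

lemma GDERIV_unique:
  fixes q :: "'a::real_inner \<Rightarrow> real"
  assumes "GDERIV q x :> D" "GDERIV q x :> E"
  shows "D = E"
proof -
  have "(\<lambda>h. h \<bullet> D) = (\<lambda>h. h \<bullet> E)"
    using assms unfolding gderiv_def by (rule has_derivative_unique)
  then have "(D - E) \<bullet> D = (D - E) \<bullet> E" by meson
  then show ?thesis
    by (metis inner_diff_right inner_eq_zero_iff right_minus_eq)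
qed

text \<open>In finite dimension a bounded linear functional is represented by the vector of its values on
  the basis, so differentiability yields a gradient.\<close>

lemma GDERIV_grad:
  fixes q :: "'a::euclidean_space \<Rightarrow> real"
  assumes "q differentiable (at x)"
  shows "GDERIV q x :> grad q x"
proof -
  obtain q' where q': "(q has_derivative q') (at x)"
    using assms by (auto simp: differentiable_def)
  then interpret bounded_linear q' by (rule has_derivative_bounded_linear)
  have "q' h = h \<bullet> (\<Sum>b\<in>Basis. q' b *\<^sub>R b)" for h
  proof -
    have "q' h = q' (\<Sum>b\<in>Basis. (h \<bullet> b) *\<^sub>R b)" by (simp add: euclidean_representation)
    also have "\<dots> = (\<Sum>b\<in>Basis. (h \<bullet> b) * q' b)" by (simp add: sum scaleR)
    also have "\<dots> = h \<bullet> (\<Sum>b\<in>Basis. q' b *\<^sub>R b)"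
      by (simp add: inner_sum_right mult.commute)
    finally show ?thesis .
  qed
  then have "q' = (\<lambda>h. h \<bullet> (\<Sum>b\<in>Basis. q' b *\<^sub>R b))" by (rule ext)
  with q' have G: "GDERIV q x :> (\<Sum>b\<in>Basis. q' b *\<^sub>R b)"
    unfolding gderiv_def by (rule has_derivative_subst)
  then show ?thesis
    unfolding grad_def by (rule theI) (rule GDERIV_unique[OF _ G])
qed

lemma GDERIV_norm_power2: "GDERIV (\<lambda>z. (norm (y - z))\<^sup>2) (x::'a::real_inner) :> - 2 *\<^sub>R (y - x)"
  unfolding gderiv_def power2_norm_eq_inner
  by (rule derivative_eq_intros refl)+ (auto simp: fun_eq_iff inner_commute inner_diff_left inner_diff_right)

lemma L_smooth_GDERIV:
  fixes f :: "'a::euclidean_space \<Rightarrow> real"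
  assumes "L_smooth L f"
  shows "GDERIV f x :> grad f x"
  using assms by (simp add: L_smooth_def GDERIV_grad)

lemma L_smooth_norm:
  assumes "L_smooth L f"
  shows "norm (grad f x - grad f y) \<le> L * norm (x - y)"
  using lipschitz_onD[of L UNIV "grad f" x y] assms by (simp add: L_smooth_def dist_norm)

lemma convex_tangent:
  fixes q :: "'a::real_inner \<Rightarrow> real"
  assumes "convex_on UNIV q" "GDERIV q x :> D"
  shows "q x + D \<bullet> (y - x) \<le> q y"
proof -
  have "q (x + s *\<^sub>R (y - x)) - q x \<le> s * (q y - q x)" if "0 < s" "s < 1" for s
    using convex_onD[OF assms(1), of s x y] that by (simp add: algebra_simps)
  from gradient_le_if_forward_difference_le[OF assms(2) this] show ?thesis by simp
qed

lemma strongly_convex_tangent: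
  fixes q :: "'a::real_inner \<Rightarrow> real"
  assumes "strongly_convex \<mu> q" "GDERIV q x :> D"
  shows "q x + D \<bullet> (y - x) + \<mu> / 2 * (norm (y - x))\<^sup>2 \<le> q y"
proof -
  have "GDERIV (\<lambda>x. q x - \<mu> / 2 * (norm x)\<^sup>2) x :> D - \<mu> *\<^sub>R x"
    using assms(2) unfolding gderiv_def power2_norm_eq_inner
    by (auto intro!: derivative_eq_intros simp: fun_eq_iff inner_diff_right) (simp add: inner_commute)
  from convex_tangent[OF assms(1)[unfolded strongly_convex_def] this, of y]
  show ?thesis unfolding power2_norm_eq_inner
    by (simp add: inner_diff_left inner_diff_right inner_commute[of y x] field_simps)
qed

text \<open>Along the segment, \<open>f\<close> minus its quadratic model has nonpositive derivative.\<close>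

lemma L_smooth_upper_bound:
  fixes f :: "'a::euclidean_space \<Rightarrow> real"
  assumes "L_smooth L f"
  shows "f y \<le> f x + grad f x \<bullet> (y - x) + L / 2 * (norm (y - x))\<^sup>2"
proof -
  define d where "d = y - x"
  define \<phi> where "\<phi> t = f (x + t *\<^sub>R d) - t * (grad f x \<bullet> d) - L / 2 * t\<^sup>2 * (norm d)\<^sup>2" for t :: real
  have "\<exists>c. (\<phi> has_real_derivative c) (at t) \<and> c \<le> 0" if "0 \<le> t" for t
  proof (intro exI conjI)
    show "(\<phi> has_real_derivative
        grad f (x + t *\<^sub>R d) \<bullet> d - grad f x \<bullet> d - L * t * (norm d)\<^sup>2) (at t)"
      unfolding \<phi>_def
      by (rule derivative_eq_intros DERIV_along_line L_smooth_GDERIV[OF assms] refl)+ auto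
    have "(grad f (x + t *\<^sub>R d) - grad f x) \<bullet> d \<le> norm (grad f (x + t *\<^sub>R d) - grad f x) * norm d"
      by (rule norm_cauchy_schwarz)
    also have "\<dots> \<le> (L * norm (x + t *\<^sub>R d - x)) * norm d"
      by (intro mult_right_mono L_smooth_norm[OF assms]) simp
    also have "\<dots> = L * t * (norm d)\<^sup>2"
      using that by (simp add: power2_eq_square)
    finally show "grad f (x + t *\<^sub>R d) \<bullet> d - grad f x \<bullet> d - L * t * (norm d)\<^sup>2 \<le> 0"
      by (simp add: inner_diff_left)
  qed
  then have "\<phi> 1 \<le> \<phi> 0"
    by (intro DERIV_nonpos_imp_nonincreasing[of 0 1]) auto
  then show ?thesis by (simp add: \<phi>_def d_def)
qed

text \<open>From \<open>y\<close> one gradient step of length \<open>1 / L\<close>, for \<open>f\<close> tilted so that \<open>x\<close> is its minimizer,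
  lowers the value by at least \<open>\<parallel>grad f y - grad f x\<parallel>\<^sup>2 / (2 * L)\<close>, and it cannot go below the value at
  \<open>x\<close>. Adding this to the same bound with \<open>x\<close> and \<open>y\<close> exchanged gives the claim.\<close>

lemma convex_smooth_cocoercive:
  fixes f :: "'a::euclidean_space \<Rightarrow> real"
  assumes "convex_on UNIV f" "L_smooth L f" "L > 0"
  shows "(norm (grad f y - grad f x))\<^sup>2 / L \<le> (grad f y - grad f x) \<bullet> (y - x)"
proof -
  have *: "f x + grad f x \<bullet> (y - x) + (norm (grad f y - grad f x))\<^sup>2 / (2 * L) \<le> f y" for x y
  proof -
    define b where "b = grad f y - grad f x"
    \<comment> \<open>The gradient step on \<open>f\<close> minus its linear part at \<open>x\<close>.\<close>
    define p where "p = y - (1 / L) *\<^sub>R b"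
    have "f x + grad f x \<bullet> (p - x) \<le> f p"
      by (rule convex_tangent[OF assms(1) L_smooth_GDERIV[OF assms(2)]])
    also have "f p \<le> f y + grad f y \<bullet> (p - y) + L / 2 * (norm (p - y))\<^sup>2"
      by (rule L_smooth_upper_bound[OF assms(2)])
    finally have "f x + grad f x \<bullet> (p - x) \<le> f y + grad f y \<bullet> (p - y) + L / 2 * (norm (p - y))\<^sup>2" .
    moreover have "grad f x \<bullet> (p - x) = grad f x \<bullet> (y - x) + grad f x \<bullet> (p - y)"
      by (simp add: inner_diff_right)
    moreover have "grad f y \<bullet> (p - y) = grad f x \<bullet> (p - y) - (b \<bullet> b) / L"
      by (simp add: p_def b_def inner_diff_left diff_divide_distrib)
    moreover have "L / 2 * (norm (p - y))\<^sup>2 = (b \<bullet> b) / (2 * L)"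
      using \<open>L > 0\<close> by (simp add: p_def dot_square_norm field_simps power2_eq_square)
    moreover have "(b \<bullet> b) / L - (b \<bullet> b) / (2 * L) = (norm b)\<^sup>2 / (2 * L)"
      by (simp add: dot_square_norm)
    ultimately show ?thesis
      unfolding b_def[symmetric] by linarith
  qed
  from *[of x y] *[of y x] show ?thesis
    by (simp add: norm_minus_commute inner_diff_left inner_diff_right field_simps)
qed

lemma GDERIV_lipschitz_bound:
  fixes q :: "'a::real_inner \<Rightarrow> real"
  assumes "\<beta>-lipschitz_on UNIV q" "GDERIV q x :> D"
  shows "norm D \<le> \<beta>"
proof -
  have "q (x + s *\<^sub>R D) - q x \<le> s * (\<beta> * norm D)" if "0 < s" for s
    using lipschitz_onD[OF assms(1), of "x + s *\<^sub>R D" x] that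
    by (simp add: dist_norm mult_ac)
  from gradient_le_if_forward_difference_le[OF assms(2) this]
  have "norm D * norm D \<le> \<beta> * norm D"
    by (simp add: power2_norm_eq_inner[symmetric] power2_eq_square)
  then show ?thesis
    using lipschitz_on_nonneg[OF assms(1)] by (cases "D = 0") auto
qed

section \<open>Subgradients of extended-valued functions\<close>

text \<open>Restricting to points where \<open>\<phi>\<close> is finite lets subgradient inequalities be added up in
  the reals.\<close>

definition subgradients :: "('a::real_inner \<Rightarrow> ereal) \<Rightarrow> 'a \<Rightarrow> 'a set" where
  "subgradients \<phi> x = {v. \<bar>\<phi> x\<bar> \<noteq> \<infinity> \<and> (\<forall>y. \<phi> x + ereal (v \<bullet> (y - x)) \<le> \<phi> y)}"

lemma subgradients_finite:
  assumes "v \<in> subgradients \<phi> x"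
  obtains r where "\<phi> x = ereal r"
  using assms by (cases "\<phi> x") (auto simp: subgradients_def)

lemma subgradients_ineq:
  assumes "v \<in> subgradients \<phi> x"
  shows "\<phi> x + ereal (v \<bullet> (y - x)) \<le> \<phi> y"
  using assms by (simp add: subgradients_def)

lemma subgradients_monotone:
  assumes "v \<in> subgradients \<phi> x" "w \<in> subgradients \<phi> y"
  shows "0 \<le> (v - w) \<bullet> (x - y)"
proof -
  obtain r s where "\<phi> x = ereal r" "\<phi> y = ereal s"
    using subgradients_finite[OF assms(1)] subgradients_finite[OF assms(2)] by metis
  with subgradients_ineq[OF assms(1), of y] subgradients_ineq[OF assms(2), of x] show ?thesis
    by (simp add: inner_diff_left inner_diff_right)
qed

lemma is_minimizer_iff: "is_minimizer \<phi> x \<longleftrightarrow> (\<forall>y. \<phi> x \<le> \<phi> y)"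
  by (simp add: is_minimizer_def is_arg_min_linorder)

text \<open>Convexity bounds \<open>\<phi>\<close> on the segment from \<open>x\<close> to \<open>y\<close> by its chord, so minimality bounds the
  decrease of \<open>q\<close> along it. This one optimality condition serves both proximal steps and the
  primal problem.\<close>

lemma minimizer_subgradient:
  assumes \<phi>: "proper_fun \<phi>" "convex_efun \<phi>" and q: "GDERIV q x :> D"
    and min: "is_minimizer (\<lambda>y. \<phi> y + ereal (q y)) x"
  shows "- D \<in> subgradients \<phi> x"
proof -
  have le: "\<phi> x + ereal (q x) \<le> \<phi> y + ereal (q y)" for y
    using min by (simp add: is_minimizer_iff)
  have not_minf: "\<phi> x \<noteq> - \<infinity>" for x using \<phi>(1) by (simp add: proper_fun_def)
  then obtain y r where "\<phi> y = ereal r"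
    using \<phi>(1) unfolding proper_fun_def by (metis ereal_cases)
  with le[of y] have "\<phi> x \<noteq> \<infinity>" by auto
  then obtain r where r: "\<phi> x = ereal r" using not_minf[of x] by (metis ereal_cases)
  have "\<phi> x + ereal (- D \<bullet> (y - x)) \<le> \<phi> y" for y
  proof (cases "\<phi> y")
    case (real r')
    have "- q (x + s *\<^sub>R (y - x)) - - q x \<le> s * (r' - r)" if s: "0 < s" "s < 1" for s
    proof -
      have "\<phi> x + ereal (q x) \<le> \<phi> ((1 - s) *\<^sub>R x + s *\<^sub>R y) + ereal (q ((1 - s) *\<^sub>R x + s *\<^sub>R y))"
        by (rule le)
      also have "\<dots> \<le> (ereal (1 - s) * \<phi> x + ereal s * \<phi> y) + ereal (q ((1 - s) *\<^sub>R x + s *\<^sub>R y))"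
        using \<phi>(2) s by (intro add_right_mono) (simp add: convex_efun_def)
      finally show ?thesis by (simp add: r real algebra_simps)
    qed
    from gradient_le_if_forward_difference_le[OF GDERIV_minus[OF q] this]
    show ?thesis by (simp add: r real)
  qed (use not_minf[of y] in \<open>auto simp: r\<close>)
  then show ?thesis by (simp add: subgradients_def r)
qed

lemma subgradient_eq_gradient:
  fixes q :: "'a::real_inner \<Rightarrow> real"
  assumes "v \<in> subgradients (\<lambda>x. ereal (q x)) x" "GDERIV q x :> D"
  shows "v = D"
proof -
  have *: "q x + v \<bullet> (y - x) \<le> q y" for y
    using assms(1) by (simp add: subgradients_def)
  have "- q (x + s *\<^sub>R (v - D)) - - q x \<le> s * (- (v \<bullet> (v - D)))" for s
    using *[of "x + s *\<^sub>R (v - D)"] by simp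
  from gradient_le_if_forward_difference_le[OF GDERIV_minus[OF assms(2)] this]
  have "(v - D) \<bullet> (v - D) \<le> 0" by (simp add: inner_diff_left)
  then show ?thesis by (metis inner_eq_zero_iff inner_ge_zero order_antisym right_minus_eq)
qed

lemma Fenchel_Young:
  assumes "\<phi> x = ereal r"
  shows "ereal (v \<bullet> x - r) \<le> conjugate \<phi> v"
proof -
  have "ereal (v \<bullet> x) - \<phi> x \<le> conjugate \<phi> v"
    unfolding conjugate_def by (rule SUP_upper) simp
  then show ?thesis by (simp add: assms)
qed

lemma conjugate_le_iff_subgradient:
  assumes "\<phi> x = ereal r"
  shows "conjugate \<phi> v \<le> ereal (v \<bullet> x - r) \<longleftrightarrow> v \<in> subgradients \<phi> x"
proof -
  have "conjugate \<phi> v \<le> ereal (v \<bullet> x - r) \<longleftrightarrow> (\<forall>y. ereal (v \<bullet> y) - \<phi> y \<le> ereal (v \<bullet> x - r))"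
    by (simp add: conjugate_def SUP_le_iff)
  also have "\<dots> \<longleftrightarrow> (\<forall>y. \<phi> x + ereal (v \<bullet> (y - x)) \<le> \<phi> y)"
  proof (intro all_cong1)
    fix y show "ereal (v \<bullet> y) - \<phi> y \<le> ereal (v \<bullet> x - r) \<longleftrightarrow> \<phi> x + ereal (v \<bullet> (y - x)) \<le> \<phi> y"
      by (cases "\<phi> y") (auto simp: assms inner_diff_right)
  qed
  finally show ?thesis by (simp add: subgradients_def assms)
qed

text \<open>The vector \<open>v\<close> attains equality in both Fenchel--Young inequalities, so the dual optimal value
  is \<open>- (F x + H x)\<close>. A dual minimizer \<open>w\<close> attains the same value and hence equality in both
  inequalities as well.\<close>

lemma dual_minimizer_subgradient:
  assumes v: "v \<in> subgradients H x" "- v \<in> subgradients F x"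
    and w: "is_minimizer (\<lambda>v. conjugate F (- v) + conjugate H v) w"
  shows "w \<in> subgradients H x"
proof -
  obtain r s where r: "H x = ereal r" "F x = ereal s"
    using subgradients_finite[OF v(1)] subgradients_finite[OF v(2)] by metis
  have "conjugate F (- w) + conjugate H w \<le> conjugate F (- v) + conjugate H v"
    using w by (simp add: is_minimizer_iff)
  also have "\<dots> \<le> ereal (- v \<bullet> x - s) + ereal (v \<bullet> x - r)"
    using v conjugate_le_iff_subgradient[of H x r v] conjugate_le_iff_subgradient[of F x s "- v"] r
    by (intro add_mono) auto
  finally have "conjugate F (- w) + conjugate H w \<le> ereal (- s - r)" by simp
  moreover have "ereal (- w \<bullet> x - s) \<le> conjugate F (- w)" "ereal (w \<bullet> x - r) \<le> conjugate H w"
    using Fenchel_Young[of F x s "- w"] Fenchel_Young[of H x r w] r by auto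
  ultimately have "conjugate H w \<le> ereal (w \<bullet> x - r)"
    by (cases "conjugate F (- w)"; cases "conjugate H w") auto
  then show ?thesis using conjugate_le_iff_subgradient[of H x r w] r(1) by simp
qed
section \<open>One iteration\<close>

lemma prox_subgradient:
  assumes "proper_fun \<phi>" "convex_efun \<phi>" "x \<in> prox \<gamma> \<phi> y"
  shows "(1 / \<gamma>) *\<^sub>R (y - x) \<in> subgradients \<phi> x"
proof -
  have "GDERIV (\<lambda>z. 1 / (2 * \<gamma>) * (norm (y - z))\<^sup>2) x :> - (1 / \<gamma>) *\<^sub>R (y - x)"
    unfolding gderiv_def
    by (rule has_derivative_subst[OF has_derivative_mult_right[OF
            GDERIV_norm_power2[of y x, unfolded gderiv_def]]]) (simp add: fun_eq_iff)
  from minimizer_subgradient[OF assms(1,2) this] assms(3) show ?thesis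
    by (simp add: prox_def)
qed

text \<open>A step is rejected only if it exceeds \<open>1 / L\<close>, so that shrinking it leaves more than \<open>\<tau> / L\<close>.\<close>

lemma step_search_exit:
  fixes f :: "'a::euclidean_space \<Rightarrow> real"
  assumes "step_search f g \<tau> z u \<gamma>in \<gamma> x"
    and "0 < \<gamma>in" "0 < \<tau>" "\<tau> < 1" "L > 0" "L_smooth L f"
  shows "0 < \<gamma> \<and> \<gamma> \<le> \<gamma>in \<and> min \<gamma>in (\<tau> / L) \<le> \<gamma> \<and>
    x \<in> prox \<gamma> g (z - \<gamma> *\<^sub>R u - \<gamma> *\<^sub>R grad f z) \<and> f x \<le> Q_model f z x \<gamma>"
  using assms
proof (induction rule: step_search.induct)
  case (shrink y \<gamma>in \<gamma> x)
  have "1 / L < \<gamma>in"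
  proof (rule ccontr)
    assume "\<not> 1 / L < \<gamma>in"
    then have "L \<le> 1 / \<gamma>in" using shrink.prems by (simp add: field_simps)
    then have "L / 2 * (norm (y - z))\<^sup>2 \<le> 1 / (2 * \<gamma>in) * (norm (y - z))\<^sup>2"
      by (intro mult_right_mono) auto
    with L_smooth_upper_bound[OF \<open>L_smooth L f\<close>, of y z] shrink.hyps(2) show False
      by (simp add: Q_model_def)
  qed
  then have "\<tau> / L \<le> \<tau> * \<gamma>in" using shrink.prems by (simp add: field_simps)
  moreover have "\<tau> * \<gamma>in \<le> \<gamma>in" using shrink.prems by simp
  moreover have "0 < \<tau> * \<gamma>in" using shrink.prems by simp
  ultimately show ?case using shrink.IH shrink.prems by linarith
qed auto

text \<open>The algorithm reduced to what the estimates use: the two proximal steps appear through their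
  optimality conditions, \<open>h\<close> is real-valued, \<open>(xs, us)\<close> is the primal-dual solution, and the
  step-sizes are constrained only by the decrease condition. In particular \<open>u t\<close> is a gradient of
  \<open>h\<close> for every \<open>t\<close> except \<open>t = 0\<close>.\<close>

locale splitting_iterates =
  fixes f h :: "'a::euclidean_space \<Rightarrow> real" and g :: "'a \<Rightarrow> ereal"
    and \<mu> L :: real and xs us :: 'a
    and \<gamma> :: "nat \<Rightarrow> real" and x z u :: "nat \<Rightarrow> 'a"
  assumes \<mu>: "0 < \<mu>" and L: "0 < L"
    and f_strong: "strongly_convex \<mu> f" and f_grad: "\<And>x. GDERIV f x :> grad f x"
    and h_convex: "convex_on UNIV h" and h_smooth: "L_smooth L h"
    and us: "us = grad h xs" and solution: "- grad f xs - us \<in> subgradients g xs"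
    and \<gamma>_pos: "0 < \<gamma> t"
    and x_step: "(1 / \<gamma> t) *\<^sub>R (z t - x (Suc t)) - u t - grad f (z t) \<in> subgradients g (x (Suc t))"
    and decrease: "f (x (Suc t)) \<le> Q_model f (z t) (x (Suc t)) (\<gamma> t)"
    and u_step: "u (Suc t) = u t + (1 / \<gamma> t) *\<^sub>R (x (Suc t) - z (Suc t))"
    and u_grad: "u (Suc t) = grad h (z (Suc t))"
begin

definition slack :: "nat \<Rightarrow> real" where
  "slack t = Q_model f (z t) (x (Suc t)) (\<gamma> t) - f (x (Suc t))"

lemma slack_nonneg: "0 \<le> slack t"
  using decrease by (simp add: slack_def)

text \<open>Strong convexity at \<open>z t\<close> and at \<open>xs\<close>, the decrease condition and monotonicity of the
  subdifferential of \<open>g\<close> add up to this estimate; all function values cancel.\<close>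

lemma forward_step:
  "(1 + \<gamma> t * \<mu>) * (norm (x (Suc t) - xs))\<^sup>2 + 2 * \<gamma> t * ((u t - us) \<bullet> (x (Suc t) - xs)) + 2 * \<gamma> t * slack t
    \<le> (1 - \<gamma> t * \<mu>) * (norm (z t - xs))\<^sup>2"
proof -
  define X Z where "X = x (Suc t) - xs" and "Z = z t - xs"
  have "0 \<le> ((1 / \<gamma> t) *\<^sub>R (Z - X) - (u t - us) - (grad f (z t) - grad f xs)) \<bullet> X"
    using subgradients_monotone[OF x_step[of t] solution] by (simp add: X_def Z_def algebra_simps)
  then have A: "0 \<le> (1 / \<gamma> t) * (Z \<bullet> X - X \<bullet> X) - (u t - us) \<bullet> X - (grad f (z t) - grad f xs) \<bullet> X"
    by (simp add: inner_diff_left right_diff_distrib)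
  have B: "f (z t) - grad f (z t) \<bullet> Z + \<mu> / 2 * (Z \<bullet> Z) \<le> f xs"
    using strongly_convex_tangent[OF f_strong f_grad, of "z t" xs]
    by (simp add: Z_def power2_norm_eq_inner inner_diff_left inner_diff_right inner_commute
        algebra_simps)
  have C: "f xs + grad f xs \<bullet> X + \<mu> / 2 * (X \<bullet> X) \<le> f (x (Suc t))"
    using strongly_convex_tangent[OF f_strong f_grad, of xs "x (Suc t)"]
    by (simp add: X_def power2_norm_eq_inner)
  have XZ: "x (Suc t) - z t = X - Z" by (simp add: X_def Z_def)
  have D: "f (x (Suc t)) + slack t = f (z t) + grad f (z t) \<bullet> (X - Z)
      + 1 / (2 * \<gamma> t) * (X \<bullet> X - 2 * (Z \<bullet> X) + Z \<bullet> Z)"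
    unfolding slack_def Q_model_def XZ power2_norm_eq_inner
    by (simp add: inner_diff_left inner_diff_right inner_commute)
  have "0 \<le> 1 / (2 * \<gamma> t) * (Z \<bullet> Z - X \<bullet> X) - (u t - us) \<bullet> X - slack t
      - \<mu> / 2 * (Z \<bullet> Z) - \<mu> / 2 * (X \<bullet> X)"
  proof -
    define i where "i = 1 / (2 * \<gamma> t)"
    have "1 / \<gamma> t = 2 * i" using \<gamma>_pos[of t] by (simp add: i_def)
    with A B C D show ?thesis
      unfolding i_def[symmetric] by (simp add: inner_diff_left inner_diff_right algebra_simps)
  qed
  then have "0 \<le> 2 * \<gamma> t * (1 / (2 * \<gamma> t) * (Z \<bullet> Z - X \<bullet> X) - (u t - us) \<bullet> X - slack t
      - \<mu> / 2 * (Z \<bullet> Z) - \<mu> / 2 * (X \<bullet> X))"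
    using \<gamma>_pos[of t] by simp
  also have "\<dots> = (Z \<bullet> Z - X \<bullet> X) - 2 * \<gamma> t * ((u t - us) \<bullet> X) - 2 * \<gamma> t * slack t
      - \<gamma> t * \<mu> * (Z \<bullet> Z) - \<gamma> t * \<mu> * (X \<bullet> X)"
    using \<gamma>_pos[of t] by (simp add: right_diff_distrib diff_divide_distrib)
  finally show ?thesis
    unfolding X_def[symmetric] Z_def[symmetric] power2_norm_eq_inner by (simp add: algebra_simps)
qed

text \<open>Substituting \<open>x (Suc t) - xs = w + \<gamma> t *\<^sub>R (b - a)\<close>, with \<open>w\<close>, \<open>a\<close>, \<open>b\<close> as in the proof,
  turns the previous estimate into one between the squared errors of the pairs \<open>(z, u)\<close> before
  and after the step. The remaining cross term \<open>b \<bullet> w\<close> is controlled by cocoercivity of the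
  gradient of \<open>h\<close>.\<close>

lemma energy_decrease:
  "(norm (z (Suc t) - xs))\<^sup>2 + ((\<gamma> t)\<^sup>2 + 2 * \<gamma> t / L) * (norm (u (Suc t) - us))\<^sup>2 + 2 * \<gamma> t * slack t
    \<le> (1 - \<gamma> t * \<mu>) * (norm (z t - xs))\<^sup>2 + (\<gamma> t)\<^sup>2 * (norm (u t - us))\<^sup>2"
proof -
  define w a b where "w = z (Suc t) - xs" and "a = u t - us" and "b = u (Suc t) - us"
  have "\<gamma> t *\<^sub>R (b - a) = x (Suc t) - z (Suc t)"
    using \<gamma>_pos[of t] by (simp add: a_def b_def u_step)
  then have X: "x (Suc t) - xs = w + \<gamma> t *\<^sub>R (b - a)"
    by (simp add: w_def)
  have "(norm (x (Suc t) - xs))\<^sup>2 + 2 * \<gamma> t * (a \<bullet> (x (Suc t) - xs))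
      = (norm w)\<^sup>2 + 2 * \<gamma> t * (b \<bullet> w) + (\<gamma> t)\<^sup>2 * ((norm b)\<^sup>2 - (norm a)\<^sup>2)"
    unfolding X power2_norm_eq_inner
    by (simp add: inner_add_left inner_add_right inner_diff_left inner_diff_right inner_commute
        algebra_simps power2_eq_square)
  moreover have "2 * \<gamma> t * ((norm b)\<^sup>2 / L) \<le> 2 * \<gamma> t * (b \<bullet> w)"
    using convex_smooth_cocoercive[OF h_convex h_smooth L, of "z (Suc t)" xs] \<gamma>_pos[of t]
    by (intro mult_left_mono) (simp_all add: b_def w_def us u_grad)
  moreover have "0 \<le> \<gamma> t * \<mu> * (norm (x (Suc t) - xs))\<^sup>2"
    using \<gamma>_pos[of t] \<mu> by simp
  ultimately show ?thesis
    using forward_step[of t] unfolding w_def[symmetric] a_def[symmetric] b_def[symmetric]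
    by (simp add: algebra_simps)
qed

text \<open>If \<open>\<gamma> * \<mu> > 1\<close>, the quadratic model in the decrease condition is strictly flatter than the
  strongly convex \<open>f\<close>, so it can be accepted only at \<open>z\<close> itself: the step does not move. After
  the first iteration the dual variable is the gradient of \<open>h\<close> at \<open>z\<close>, and an unmoved \<open>z\<close> is
  then already the solution. For the first iteration this would fail, since \<open>u 0\<close> is arbitrary.\<close>

lemma stationary_if_large_step:
  assumes "1 < \<gamma> (Suc t) * \<mu>"
  shows "z (Suc t) = xs \<and> u (Suc t) = us"
proof -
  let ?t = "Suc t"
  define r where "r = (norm (x (Suc ?t) - z ?t))\<^sup>2"
  have "\<mu> / 2 * r \<le> 1 / (2 * \<gamma> ?t) * r"
    using decrease[of ?t] strongly_convex_tangent[OF f_strong f_grad, of "z ?t" "x (Suc ?t)"]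
    by (simp add: Q_model_def r_def)
  then have "(\<gamma> ?t * \<mu>) * r \<le> 1 * r"
    using \<gamma>_pos[of ?t] by (simp add: field_simps)
  then have "r \<le> 0"
    using assms by (metis mult_le_cancel_right not_less)
  then have [simp]: "x (Suc ?t) = z ?t" by (simp add: r_def)
  have "0 \<le> (norm (u ?t - us))\<^sup>2 / L" using L by simp
  also have "\<dots> \<le> (u ?t - us) \<bullet> (z ?t - xs)"
    using convex_smooth_cocoercive[OF h_convex h_smooth L, of "z ?t" xs] by (simp add: us u_grad)
  finally have "0 \<le> 2 * \<gamma> ?t * ((u ?t - us) \<bullet> (z ?t - xs)) + 2 * \<gamma> ?t * slack ?t"
    using \<gamma>_pos[of ?t] slack_nonneg[of ?t] by simp
  with forward_step[of ?t] have "(\<gamma> ?t * \<mu>) * (norm (z ?t - xs))\<^sup>2 \<le> 0"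
    by (simp add: algebra_simps)
  then have "z ?t = xs"
    using \<gamma>_pos[of ?t] \<mu> by (simp add: mult_le_0_iff)
  then show ?thesis by (simp add: u_grad us)
qed

section \<open>Linear rates\<close>

text \<open>The Lyapunov function is \<open>V\<close>. The weight \<open>c t\<close> exceeds \<open>(\<gamma> t)\<^sup>2\<close> enough to make the right-hand side
  of the energy estimate at most \<open>(1 - m) * V t\<close>, and the surplus terms on its left-hand side must
  pay for the weight \<open>c (Suc t)\<close>. The alternative \<open>V (Suc t) = 0\<close> covers step-sizes that occur
  only at the solution. The factor 6 comes from passing from \<open>z\<close> to \<open>x\<close>: the error of
  \<open>x (Suc t)\<close> is a combination of three vectors, whose squared norms are bounded by twice
  \<open>(1 - m) * V t\<close> in total.\<close>

lemma linear_rate: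
  fixes c :: "nat \<Rightarrow> real"
  defines "V \<equiv> \<lambda>t. (norm (z t - xs))\<^sup>2 + c t * (norm (u t - us))\<^sup>2"
  assumes m: "m \<le> 1" "\<And>t. m \<le> \<gamma> t * \<mu>" and c: "\<And>t. (\<gamma> t)\<^sup>2 \<le> (1 - m) * c t"
    and next_weight: "\<And>t. c (Suc t) * (norm (u (Suc t) - us))\<^sup>2
        \<le> ((\<gamma> t)\<^sup>2 + 2 * \<gamma> t / L) * (norm (u (Suc t) - us))\<^sup>2 + 2 * \<gamma> t * slack t \<or> V (Suc t) = 0"
  shows "(norm (x (Suc t) - xs))\<^sup>2 \<le> (1 - m) ^ (t + 1) * (6 * V 0)"
proof -
  have dual: "(\<gamma> t)\<^sup>2 * (norm (u t - us))\<^sup>2 \<le> (1 - m) * (c t * (norm (u t - us))\<^sup>2)" for t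
    using mult_right_mono[OF c[of t], of "(norm (u t - us))\<^sup>2"] by (simp add: mult_ac)
  have dual0: "0 \<le> (1 - m) * (c t * (norm (u t - us))\<^sup>2)" for t
    by (rule order_trans[OF _ dual]) simp
  have primal: "(1 - \<gamma> t * \<mu>) * (norm (z t - xs))\<^sup>2 \<le> (1 - m) * (norm (z t - xs))\<^sup>2" for t
    using m(2)[of t] by (intro mult_right_mono) auto
  have energy: "(norm (z (Suc t) - xs))\<^sup>2 + ((\<gamma> t)\<^sup>2 + 2 * \<gamma> t / L) * (norm (u (Suc t) - us))\<^sup>2
      + 2 * \<gamma> t * slack t \<le> (1 - m) * V t" for t
    using energy_decrease[of t] primal[of t] dual[of t] unfolding V_def distrib_left by linarith
  have V_nonneg: "0 \<le> (1 - m) * V t" for t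
    using dual0[of t] m(1) by (simp add: V_def distrib_left)
  have V_step: "V (Suc t) \<le> (1 - m) * V t" for t
  proof (cases "V (Suc t) = 0")
    case False
    with next_weight[of t] energy[of t] show ?thesis by (auto simp: V_def)
  qed (use V_nonneg in simp)
  have V_pow: "V t \<le> (1 - m) ^ t * V 0" for t
  proof (induction t)
    case (Suc t)
    have "(1 - m) * V t \<le> (1 - m) * ((1 - m) ^ t * V 0)"
      using Suc m(1) by (intro mult_left_mono) auto
    with V_step[of t] show ?case by simp
  qed simp
  define w a b where "w = z (Suc t) - xs" and "a = \<gamma> t *\<^sub>R (u t - us)" and "b = \<gamma> t *\<^sub>R (u (Suc t) - us)"
  have "x (Suc t) - xs = w + b - a"
    using \<gamma>_pos[of t] by (simp add: w_def a_def b_def u_step algebra_simps)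
  then have "(norm (x (Suc t) - xs))\<^sup>2 \<le> (norm w + norm b + norm a)\<^sup>2"
    using norm_triangle_ineq4[of "w + b" a] norm_triangle_ineq[of w b] by (intro power_mono) auto
  also have "\<dots> \<le> 3 * ((norm w)\<^sup>2 + (norm b)\<^sup>2 + (norm a)\<^sup>2)"
    using zero_le_power2[of "norm w - norm b"]
      zero_le_power2[of "norm w - norm a"] zero_le_power2[of "norm a - norm b"]
    by (simp add: power2_eq_square algebra_simps)
  also have "(norm w)\<^sup>2 + (norm b)\<^sup>2 \<le> (1 - m) * V t"
  proof -
    have "0 \<le> 2 * \<gamma> t / L * (norm (u (Suc t) - us))\<^sup>2 + 2 * \<gamma> t * slack t"
      using \<gamma>_pos[of t] L slack_nonneg[of t] by simp
    with energy[of t] show ?thesis by (simp add: w_def b_def power_mult_distrib distrib_right)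
  qed
  also have "(norm a)\<^sup>2 \<le> (1 - m) * V t"
    using dual[of t] m(1) by (simp add: a_def power_mult_distrib V_def distrib_left add_increasing)
  also have "3 * ((1 - m) * V t + (1 - m) * V t) = (1 - m) * (6 * V t)" by simp
  also have "\<dots> \<le> (1 - m) * (6 * ((1 - m) ^ t * V 0))"
    using V_pow[of t] m(1) by (intro mult_left_mono) auto
  finally show ?thesis by (simp add: mult_ac)
qed

text \<open>The weight \<open>(\<gamma> t)\<^sup>2 + \<gamma> t / L = (\<gamma> t)\<^sup>2 / (1 - 1 / (1 + \<gamma> t * L))\<close> grows only with the step-size, so here
  it is paid for by the cocoercivity term alone.\<close>

lemma rate_nonincreasing_steps:
  assumes \<gamma>_lower: "\<And>t. min (\<gamma> 0) \<eta> \<le> \<gamma> t" and \<gamma>_dec: "\<And>t. \<gamma> (Suc t) \<le> \<gamma> t"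
  defines "\<sigma> \<equiv> 1 / (1 + \<gamma> 0 * L)"
  shows "(norm (x (Suc t) - xs))\<^sup>2 \<le> (1 - min (\<mu> * min (\<gamma> 0) \<eta>) \<sigma>) ^ (t + 1) *
    (6 * (norm (z 0 - xs))\<^sup>2 + 6 / (1 - \<sigma>) * (norm (\<gamma> 0 *\<^sub>R (u 0 - us)))\<^sup>2)"
proof -
  define m where "m = min (\<mu> * min (\<gamma> 0) \<eta>) \<sigma>"
  define c where "c t = (\<gamma> t)\<^sup>2 + \<gamma> t / L" for t
  have \<gamma>_le: "\<gamma> t \<le> \<gamma> 0" for t
    using \<gamma>_dec by (induction t) (auto intro: order_trans)
  have m_le: "m \<le> 1 / (1 + \<gamma> t * L)" for t
  proof -
    have "m \<le> \<sigma>" by (simp add: m_def)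
    also have "\<dots> \<le> 1 / (1 + \<gamma> t * L)"
      unfolding \<sigma>_def using \<gamma>_pos[of 0] \<gamma>_pos[of t] \<gamma>_le[of t] L
      by (intro divide_left_mono add_left_mono mult_right_mono mult_pos_pos add_pos_pos) auto
    finally show ?thesis .
  qed
  have "m \<le> 1"
    by (rule order_trans[OF m_le[of 0]]) (use mult_pos_pos[OF \<gamma>_pos[of 0] L] in simp)
  moreover have "m \<le> \<gamma> t * \<mu>" for t
  proof -
    have "m \<le> \<mu> * min (\<gamma> 0) \<eta>" by (simp add: m_def)
    also have "\<dots> \<le> \<mu> * \<gamma> t" using \<gamma>_lower \<mu> by (intro mult_left_mono) auto
    finally show ?thesis by (simp add: mult.commute)
  qed
  moreover have "(\<gamma> t)\<^sup>2 \<le> (1 - m) * c t" for t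
  proof -
    define q where "q = 1 + \<gamma> t * L"
    have q: "q > 0" using \<gamma>_pos[of t] L by (simp add: q_def add_pos_pos)
    have "1 - 1 / q = \<gamma> t * L / q" using q by (simp add: field_simps) (simp add: q_def)
    moreover have "c t = \<gamma> t / L * q" using L by (simp add: c_def q_def field_simps power2_eq_square)
    ultimately have "(\<gamma> t)\<^sup>2 = (1 - 1 / (1 + \<gamma> t * L)) * c t"
      using q L by (simp add: q_def[symmetric] power2_eq_square)
    also have "\<dots> \<le> (1 - m) * c t"
      using m_le[of t] \<gamma>_pos[of t] L by (intro mult_right_mono) (auto simp: c_def)
    finally show ?thesis .
  qed
  moreover have "c (Suc t) * (norm (u (Suc t) - us))\<^sup>2
      \<le> ((\<gamma> t)\<^sup>2 + 2 * \<gamma> t / L) * (norm (u (Suc t) - us))\<^sup>2 + 2 * \<gamma> t * slack t" for t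
  proof -
    have "\<gamma> (Suc t) / L \<le> \<gamma> t / L"
      using \<gamma>_dec[of t] L by (simp add: divide_right_mono)
    moreover have "\<gamma> t / L \<le> 2 * \<gamma> t / L"
      using \<gamma>_pos[of t] L by (simp add: divide_right_mono)
    moreover have "(\<gamma> (Suc t))\<^sup>2 \<le> (\<gamma> t)\<^sup>2"
      using \<gamma>_dec[of t] \<gamma>_pos[of "Suc t"] by (intro power_mono) auto
    ultimately have "c (Suc t) * (norm (u (Suc t) - us))\<^sup>2
        \<le> ((\<gamma> t)\<^sup>2 + 2 * \<gamma> t / L) * (norm (u (Suc t) - us))\<^sup>2"
      by (intro mult_right_mono) (auto simp: c_def)
    with slack_nonneg[of t] \<gamma>_pos[of t] show ?thesis by (simp add: add_increasing2)
  qed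
  ultimately have "(norm (x (Suc t) - xs))\<^sup>2
      \<le> (1 - m) ^ (t + 1) * (6 * ((norm (z 0 - xs))\<^sup>2 + c 0 * (norm (u 0 - us))\<^sup>2))"
    by (intro linear_rate) auto
  moreover have "c 0 = (\<gamma> 0)\<^sup>2 / (1 - \<sigma>)"
  proof -
    have "1 + \<gamma> 0 * L > 0" using \<gamma>_pos[of 0] L by (simp add: add_pos_pos)
    then have *: "1 - \<sigma> = \<gamma> 0 * L / (1 + \<gamma> 0 * L)" by (simp add: \<sigma>_def field_simps)
    show ?thesis
      unfolding * c_def using \<gamma>_pos[of 0] L by (simp add: field_simps power2_eq_square)
  qed
  ultimately show ?thesis by (simp add: m_def power_mult_distrib)
qed

text \<open>Gradients of \<open>h\<close> have norm at most \<open>\<beta>\<close>, so the growth rule makes the increase of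
  \<open>(\<gamma> t)\<^sup>2 * \<parallel>u (Suc t) - us\<parallel>\<^sup>2\<close> at most \<open>\<gamma> t * slack t\<close>, half of the slack in the energy estimate.
  With the weight \<open>(1 + \<kappa>) * (\<gamma> t)\<^sup>2\<close> the other half pays for the increase of the \<open>\<kappa>\<close>-part, which
  is where \<open>\<kappa> \<le> 1\<close>, and hence the rate \<open>1 / 2\<close>, comes from. The rest of the \<open>\<kappa>\<close>-part is
  paid for by the cocoercivity term as long as the new step-size is at most \<open>1 / \<mu>\<close>; beyond that the
  new iterate is the solution.\<close>

lemma rate_growing_steps:
  assumes \<gamma>_lower: "\<And>t. min (\<gamma> 0) \<eta> \<le> \<gamma> t" and \<beta>: "0 < \<beta>" "\<beta>-lipschitz_on UNIV h"
    and \<gamma>_growth: "\<And>t. (\<gamma> (Suc t))\<^sup>2 \<le> (\<gamma> t)\<^sup>2 + \<gamma> t * slack t / (2 * \<beta>)\<^sup>2"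
  defines "\<xi> \<equiv> \<mu> / (\<mu> + L)"
  shows "(norm (x (Suc t) - xs))\<^sup>2 \<le> (1 - min (\<mu> * min (\<gamma> 0) \<eta>) (min \<xi> (1 / 2))) ^ (t + 1) *
    (6 * (norm (z 0 - xs))\<^sup>2 + 6 / (1 - \<xi>) * (norm (\<gamma> 0 *\<^sub>R (u 0 - us)))\<^sup>2)"
proof -
  define m where "m = min (\<mu> * min (\<gamma> 0) \<eta>) (min \<xi> (1 / 2))"
  define \<kappa> where "\<kappa> = min (\<mu> / L) 1"
  define c where "c t = (1 + \<kappa>) * (\<gamma> t)\<^sup>2" for t
  have \<kappa>: "0 \<le> \<kappa>" "\<kappa> \<le> 1" "\<kappa> \<le> \<mu> / L" using \<mu> L by (auto simp: \<kappa>_def)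
  have "m \<le> 1" by (simp add: m_def)
  moreover have "m \<le> \<gamma> t * \<mu>" for t
  proof -
    have "m \<le> \<mu> * min (\<gamma> 0) \<eta>" by (simp add: m_def)
    also have "\<dots> \<le> \<mu> * \<gamma> t" using \<gamma>_lower \<mu> by (intro mult_left_mono) auto
    finally show ?thesis by (simp add: mult.commute)
  qed
  moreover have "(\<gamma> t)\<^sup>2 \<le> (1 - m) * c t" for t
  proof -
    \<comment> \<open>The parameter \<open>\<kappa>\<close> is chosen so that \<open>\<kappa> / (1 + \<kappa>) = min \<xi> (1 / 2)\<close>.\<close>
    have "m \<le> min \<xi> (1 / 2)" unfolding m_def by (rule min.cobounded2)
    also have "\<dots> \<le> \<kappa> / (1 + \<kappa>)"
    proof (cases "\<mu> \<le> L")
      case True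
      then have "\<kappa> = \<mu> / L" using L by (simp add: \<kappa>_def min_def)
      moreover have "1 + \<mu> / L = (\<mu> + L) / L" using L by (simp add: field_simps)
      ultimately show ?thesis using L by (simp add: \<xi>_def)
    next
      case False
      then have "\<kappa> = 1" using L by (simp add: \<kappa>_def min_def field_simps)
      then show ?thesis by simp
    qed
    finally have "1 \<le> (1 - m) * (1 + \<kappa>)"
      using \<kappa>(1) by (simp add: field_simps)
    from mult_right_mono[OF this, of "(\<gamma> t)\<^sup>2"] show ?thesis by (simp add: c_def mult_ac)
  qed
  moreover have "c (Suc t) * (norm (u (Suc t) - us))\<^sup>2
      \<le> ((\<gamma> t)\<^sup>2 + 2 * \<gamma> t / L) * (norm (u (Suc t) - us))\<^sup>2 + 2 * \<gamma> t * slack t \<or>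
      (norm (z (Suc t) - xs))\<^sup>2 + c (Suc t) * (norm (u (Suc t) - us))\<^sup>2 = 0" for t
  proof (cases "1 < \<gamma> (Suc t) * \<mu>")
    case True
    with stationary_if_large_step[OF True] show ?thesis by simp
  next
    case False
    define B where "B = (norm (u (Suc t) - us))\<^sup>2"
    have "norm (u (Suc t) - us) \<le> norm (u (Suc t)) + norm us" by (rule norm_triangle_ineq4)
    also have "\<dots> \<le> 2 * \<beta>"
      using GDERIV_lipschitz_bound[OF \<beta>(2) L_smooth_GDERIV[OF h_smooth], of "z (Suc t)"]
        GDERIV_lipschitz_bound[OF \<beta>(2) L_smooth_GDERIV[OF h_smooth], of xs]
      by (simp add: u_grad us)
    finally have "B \<le> (2 * \<beta>)\<^sup>2"
      unfolding B_def by (intro power_mono) auto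
    then have B1: "B / (2 * \<beta>)\<^sup>2 \<le> 1"
      using \<beta>(1) by simp
    have B0: "0 \<le> B" by (simp add: B_def)
    have s0: "0 \<le> \<gamma> t * slack t" using \<gamma>_pos[of t] slack_nonneg[of t] by simp
    from B1 s0 have "\<gamma> t * slack t * (B / (2 * \<beta>)\<^sup>2) \<le> \<gamma> t * slack t"
      by (rule mult_left_le)
    with mult_right_mono[OF \<gamma>_growth[of t] B0]
    have grow: "(\<gamma> (Suc t))\<^sup>2 * B \<le> (\<gamma> t)\<^sup>2 * B + \<gamma> t * slack t"
      by (simp add: distrib_right)
    \<comment> \<open>Short steps \<open>s \<le> 1 / \<mu>\<close> are those for which cocoercivity pays for the \<open>\<kappa>\<close>-part.\<close>
    have short: "\<kappa> * s\<^sup>2 \<le> s / L" if "0 < s" "s * \<mu> \<le> 1" for s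
    proof -
      have "\<kappa> * s\<^sup>2 \<le> \<mu> / L * s\<^sup>2" using \<kappa>(3) by (intro mult_right_mono) auto
      also have "\<dots> = (s * \<mu>) * (s / L)" by (simp add: power2_eq_square)
      also have "\<dots> \<le> s / L" using that \<mu> L by (intro mult_left_le_one_le) auto
      finally show ?thesis .
    qed
    have \<kappa>_part: "\<kappa> * ((\<gamma> (Suc t))\<^sup>2 * B) \<le> \<gamma> t / L * B + \<gamma> t * slack t"
    proof (cases "\<gamma> (Suc t) \<le> \<gamma> t")
      case True
      have "\<kappa> * (\<gamma> (Suc t))\<^sup>2 \<le> \<gamma> (Suc t) / L"
        using False \<gamma>_pos[of "Suc t"] by (intro short) auto
      also have "\<dots> \<le> \<gamma> t / L" using True L by (simp add: divide_right_mono)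
      finally have "\<kappa> * (\<gamma> (Suc t))\<^sup>2 * B \<le> \<gamma> t / L * B" using B0 by (intro mult_right_mono)
      with s0 show ?thesis by (simp add: mult.assoc)
    next
      case le: False
      have "\<gamma> t * \<mu> \<le> \<gamma> (Suc t) * \<mu>" using le \<mu> by (intro mult_right_mono) auto
      then have "\<kappa> * (\<gamma> t)\<^sup>2 \<le> \<gamma> t / L"
        using False \<gamma>_pos[of t] by (intro short) auto
      then have "\<kappa> * (\<gamma> t)\<^sup>2 * B \<le> \<gamma> t / L * B" using B0 by (intro mult_right_mono)
      moreover have "\<kappa> * (\<gamma> t * slack t) \<le> \<gamma> t * slack t"
        using \<kappa> s0 by (intro mult_left_le_one_le) auto
      moreover have "\<kappa> * ((\<gamma> (Suc t))\<^sup>2 * B) \<le> \<kappa> * ((\<gamma> t)\<^sup>2 * B + \<gamma> t * slack t)"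
        using grow \<kappa>(1) by (intro mult_left_mono) auto
      ultimately show ?thesis by (simp add: distrib_left mult.assoc)
    qed
    have "c (Suc t) * B = (\<gamma> (Suc t))\<^sup>2 * B + \<kappa> * ((\<gamma> (Suc t))\<^sup>2 * B)"
      by (simp add: c_def distrib_right)
    also have "\<dots> \<le> ((\<gamma> t)\<^sup>2 * B + \<gamma> t * slack t) + (\<gamma> t / L * B + \<gamma> t * slack t)"
      by (intro add_mono grow \<kappa>_part)
    also have "\<dots> = ((\<gamma> t)\<^sup>2 + \<gamma> t / L) * B + 2 * \<gamma> t * slack t"
      by (simp add: distrib_right)
    also have "\<dots> \<le> ((\<gamma> t)\<^sup>2 + 2 * \<gamma> t / L) * B + 2 * \<gamma> t * slack t"
      using \<gamma>_pos[of t] L B0 by (intro add_right_mono mult_right_mono add_left_mono divide_right_mono) auto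
    finally have "c (Suc t) * B \<le> ((\<gamma> t)\<^sup>2 + 2 * \<gamma> t / L) * B + 2 * \<gamma> t * slack t" .
    then show ?thesis by (simp add: B_def)
  qed
  ultimately have "(norm (x (Suc t) - xs))\<^sup>2
      \<le> (1 - m) ^ (t + 1) * (6 * ((norm (z 0 - xs))\<^sup>2 + c 0 * (norm (u 0 - us))\<^sup>2))"
    by (intro linear_rate) auto
  also have "\<dots> \<le> (1 - m) ^ (t + 1) *
      (6 * ((norm (z 0 - xs))\<^sup>2 + 1 / (1 - \<xi>) * (\<gamma> 0)\<^sup>2 * (norm (u 0 - us))\<^sup>2))"
  proof -
    have "1 - \<xi> = L / (\<mu> + L)" using \<mu> L by (simp add: \<xi>_def field_simps)
    then have "1 / (1 - \<xi>) = 1 + \<mu> / L" using L by (simp add: add_divide_distrib)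
    then have "1 + \<kappa> \<le> 1 / (1 - \<xi>)" using \<kappa>(3) by simp
    then show ?thesis
      unfolding c_def using \<open>m \<le> 1\<close> \<gamma>_pos[of 0]
      by (intro mult_left_mono add_left_mono mult_right_mono zero_le_power) auto
  qed
  finally show ?thesis by (simp add: m_def power_mult_distrib)
qed

end

theorem theorem3:
  fixes f :: "real ^ 'p \<Rightarrow> real" and g h :: "real ^ 'p \<Rightarrow> ereal"
    and L\<^sub>f \<mu>\<^sub>f L\<^sub>h \<tau> :: real
    and \<gamma>in \<gamma> :: "nat \<Rightarrow> real"
    and x z u :: "nat \<Rightarrow> real ^ 'p"
    and xstar ustar :: "real ^ 'p"
  defines "\<rho> \<equiv> \<mu>\<^sub>f * min (\<gamma> 0) (\<tau> / L\<^sub>f)"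
    and "\<sigma> \<equiv> 1 / (1 + \<gamma> 0 * L\<^sub>h)"
    and "\<xi> \<equiv> \<mu>\<^sub>f / (\<mu>\<^sub>f + L\<^sub>h)"
  defines "D\<^sub>0 \<equiv> 6 * (norm (z 0 - xstar))\<^sup>2 + 6 / (1 - \<sigma>) * (norm (\<gamma> 0 *\<^sub>R (u 0 - ustar)))\<^sup>2"
    and "E\<^sub>0 \<equiv> 6 * (norm (z 0 - xstar))\<^sup>2 + 6 / (1 - \<xi>) * (norm (\<gamma> 0 *\<^sub>R (u 0 - ustar)))\<^sup>2"
  assumes "convex_on UNIV f" and "L\<^sub>f > 0" and "L_smooth L\<^sub>f f"
    and "proper_fun g" and "lsc_fun g" and "convex_efun g"
    and "proper_fun h" and "lsc_fun h" and "convex_efun h"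
    and "rel_interior (edom g) \<inter> rel_interior (edom h) \<noteq> {}"
    and "\<mu>\<^sub>f > 0" and "strongly_convex \<mu>\<^sub>f f"
    and "L\<^sub>h > 0" and "L_smooth_efun L\<^sub>h h"
    and "is_minimizer (\<lambda>y. ereal (f y) + g y + h y) xstar"
    and "is_minimizer (\<lambda>v. conjugate (\<lambda>y. ereal (f y) + g y) (- v) + conjugate h v) ustar"
    and "0 < \<tau>" and "\<tau> < 1"
  shows "(atos_run variant1 f g h \<tau> \<gamma>in \<gamma> x z u \<longrightarrow>
           (\<forall>t. (norm (x (Suc t) - xstar))\<^sup>2 \<le> (1 - min \<rho> \<sigma>) ^ (t + 1) * D\<^sub>0)) \<and>
         (\<forall>\<beta>\<^sub>h > 0. lipschitz_efun \<beta>\<^sub>h h \<longrightarrow> atos_run (variant2 \<beta>\<^sub>h) f g h \<tau> \<gamma>in \<gamma> x z u \<longrightarrow>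
           (\<forall>t. (norm (x (Suc t) - xstar))\<^sup>2 \<le> (1 - min \<rho> (min \<xi> (1 / 2))) ^ (t + 1) * E\<^sub>0))"
proof -
  define H where "H y = real_of_ereal (h y)" for y
  have H: "h y = ereal (H y)" for y
    using \<open>L_smooth_efun L\<^sub>h h\<close> by (simp add: L_smooth_efun_def finite_fun_def H_def ereal_real)
  then have h_eq: "h = (\<lambda>y. ereal (H y))" by blast
  have H_smooth: "L_smooth L\<^sub>h H"
    using \<open>L_smooth_efun L\<^sub>h h\<close> by (simp add: L_smooth_efun_def H_def[abs_def])
  note H_grad = L_smooth_GDERIV[OF H_smooth] and f_grad = L_smooth_GDERIV[OF \<open>L_smooth L\<^sub>f f\<close>]
  have H_convex: "convex_on UNIV H"
  proof (rule convex_onI)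
    fix t :: real and x y assume "0 < t" "t < 1"
    then have "t \<in> {0..1}" by simp
    with \<open>convex_efun h\<close> have "h ((1 - t) *\<^sub>R x + t *\<^sub>R y) \<le> ereal (1 - t) * h x + ereal t * h y"
      unfolding convex_efun_def by blast
    then show "H ((1 - t) *\<^sub>R x + t *\<^sub>R y) \<le> (1 - t) * H x + t * H y" by (simp add: H)
  qed simp
  have "is_minimizer (\<lambda>y. g y + ereal (f y + H y)) xstar"
    using \<open>is_minimizer (\<lambda>y. ereal (f y) + g y + h y) xstar\<close>
    by (simp add: H add_ac flip: plus_ereal.simps(1))
  from minimizer_subgradient[OF \<open>proper_fun g\<close> \<open>convex_efun g\<close> GDERIV_add[OF f_grad H_grad] this]
  have g_sub: "- grad f xstar - grad H xstar \<in> subgradients g xstar" by simp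
  \<comment> \<open>The gradient of \<open>h\<close> at \<open>xstar\<close> is a dual certificate, and \<open>h\<close> has no other subgradient there.\<close>
  have ustar: "ustar = grad H xstar"
  proof -
    have h_sub: "grad H xstar \<in> subgradients h xstar"
      using convex_tangent[OF H_convex H_grad] by (simp add: subgradients_def H)
    obtain r where r: "g xstar = ereal r"
      using g_sub by (rule subgradients_finite)
    have g_ge: "ereal (r + (- grad f xstar - grad H xstar) \<bullet> (y - xstar)) \<le> g y" for y
      using subgradients_ineq[OF g_sub, of y] by (simp add: r)
    have "- grad H xstar \<in> subgradients (\<lambda>y. ereal (f y) + g y) xstar"
    proof -
      have "ereal (f xstar) + g xstar + ereal (- grad H xstar \<bullet> (y - xstar)) \<le> ereal (f y) + g y" for y
      proof -
        have "ereal (f xstar) + g xstar + ereal (- grad H xstar \<bullet> (y - xstar))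
            = ereal (f xstar + grad f xstar \<bullet> (y - xstar))
              + ereal (r + (- grad f xstar - grad H xstar) \<bullet> (y - xstar))"
          by (simp add: r inner_diff_left)
        also have "\<dots> \<le> ereal (f y) + g y"
          using convex_tangent[OF \<open>convex_on UNIV f\<close> f_grad] g_ge by (intro add_mono) auto
        finally show ?thesis .
      qed
      then show ?thesis by (simp add: subgradients_def r)
    qed
    from dual_minimizer_subgradient[OF h_sub this
        \<open>is_minimizer (\<lambda>v. conjugate (\<lambda>y. ereal (f y) + g y) (- v) + conjugate h v) ustar\<close>]
    show ?thesis
      unfolding h_eq by (rule subgradient_eq_gradient[OF _ H_grad])
  qed
  \<comment> \<open>Both variants never shrink the step-size between iterations; with the bound on rejected
    steps this gives the uniform lower bound on \<open>\<gamma> t\<close>.\<close>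
  have run: "splitting_iterates f H g \<mu>\<^sub>f L\<^sub>h xstar ustar \<gamma> x z u
      \<and> (\<forall>t. min (\<gamma> 0) (\<tau> / L\<^sub>f) \<le> \<gamma> t) \<and> (\<forall>t. 0 < \<gamma> t \<and> \<gamma> t \<le> \<gamma>in t)
      \<and> (\<forall>t. 0 \<le> Q_model f (z t) (x (Suc t)) (\<gamma> t) - f (x (Suc t)))"
    if run: "atos_run next_step f g h \<tau> \<gamma>in \<gamma> x z u"
      and grow: "\<And>t \<delta> \<gamma>'. 0 \<le> \<delta> \<Longrightarrow> next_step (\<gamma> t) \<delta> \<gamma>' \<Longrightarrow> \<gamma> t \<le> \<gamma>'" for next_step
  proof -
    have next_rule: "next_step (\<gamma> t) (Q_model f (z t) (x (Suc t)) (\<gamma> t) - f (x (Suc t))) (\<gamma>in (Suc t))" for t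
      using run by (simp add: atos_run_def)
    have "step_search f g \<tau> (z t) (u t) (\<gamma>in t) (\<gamma> t) (x (Suc t))" for t
      using run by (simp add: atos_run_def)
    note exit = step_search_exit[OF this _ \<open>0 < \<tau>\<close> \<open>\<tau> < 1\<close> \<open>L\<^sub>f > 0\<close> \<open>L_smooth L\<^sub>f f\<close>]
    have in_pos: "0 < \<gamma>in t" for t
    proof (induction t)
      case (Suc t)
      from exit[OF Suc] have "0 < \<gamma> t" "0 \<le> Q_model f (z t) (x (Suc t)) (\<gamma> t) - f (x (Suc t))"
        by auto
      with grow[OF this(2) next_rule[of t]] show ?case by simp
    qed (use run in \<open>simp add: atos_run_def\<close>)
    note exit = exit[OF in_pos]
    have "0 \<le> Q_model f (z t) (x (Suc t)) (\<gamma> t) - f (x (Suc t))" for t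
      using exit[of t] by simp
    note in_ge = grow[OF this next_rule]
    have lower: "min (\<gamma> 0) (\<tau> / L\<^sub>f) \<le> \<gamma> t" for t
    proof (induction t)
      case (Suc t)
      with in_ge[of t] exit[of "Suc t"] show ?case by linarith
    qed simp
    have "splitting_iterates f H g \<mu>\<^sub>f L\<^sub>h xstar ustar \<gamma> x z u"
    proof
      fix t
      show "0 < \<gamma> t" "f (x (Suc t)) \<le> Q_model f (z t) (x (Suc t)) (\<gamma> t)"
        using exit[of t] by auto
      show u_step: "u (Suc t) = u t + (1 / \<gamma> t) *\<^sub>R (x (Suc t) - z (Suc t))"
        using run by (simp add: atos_run_def)
      have "x (Suc t) \<in> prox (\<gamma> t) g (z t - \<gamma> t *\<^sub>R u t - \<gamma> t *\<^sub>R grad f (z t))"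
        using exit[of t] by auto
      from prox_subgradient[OF \<open>proper_fun g\<close> \<open>convex_efun g\<close> this]
      show "(1 / \<gamma> t) *\<^sub>R (z t - x (Suc t)) - u t - grad f (z t) \<in> subgradients g (x (Suc t))"
        using \<open>0 < \<gamma> t\<close> by (simp add: scaleR_diff_right algebra_simps)
      have "z (Suc t) \<in> prox (\<gamma> t) h (x (Suc t) + \<gamma> t *\<^sub>R u t)"
        using run by (simp add: atos_run_def)
      from prox_subgradient[OF \<open>proper_fun h\<close> \<open>convex_efun h\<close> this]
      have "u (Suc t) \<in> subgradients h (z (Suc t))"
        using \<open>0 < \<gamma> t\<close> by (simp add: u_step scaleR_diff_right scaleR_add_right algebra_simps)
      then show "u (Suc t) = grad H (z (Suc t))"
        unfolding h_eq by (rule subgradient_eq_gradient[OF _ H_grad])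
    qed (use g_sub in \<open>auto simp: ustar assms f_grad H_convex H_smooth\<close>)
    with lower exit show ?thesis by auto
  qed
  show ?thesis
  proof (intro conjI impI allI)
    fix t assume v1: "atos_run variant1 f g h \<tau> \<gamma>in \<gamma> x z u"
    note r = run[OF v1]
    interpret splitting_iterates f H g \<mu>\<^sub>f L\<^sub>h xstar ustar \<gamma> x z u
      using r by (simp add: variant1_def)
    have "\<gamma> (Suc t) \<le> \<gamma> t" for t
      using r v1 by (simp add: variant1_def atos_run_def) metis
    then show "(norm (x (Suc t) - xstar))\<^sup>2 \<le> (1 - min \<rho> \<sigma>) ^ (t + 1) * D\<^sub>0"
      unfolding \<rho>_def \<sigma>_def D\<^sub>0_def
      using r by (intro rate_nonincreasing_steps) (auto simp: variant1_def)
  next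
    fix \<beta> t assume \<beta>: "0 < \<beta>" "lipschitz_efun \<beta> h" and v2: "atos_run (variant2 \<beta>) f g h \<tau> \<gamma>in \<gamma> x z u"
    have "\<gamma> t \<le> \<gamma>'" if "variant2 \<beta> (\<gamma> t) \<delta> \<gamma>'" for t \<delta> \<gamma>'
      using that by (simp add: variant2_def)
    note r = run[OF v2 this]
    interpret splitting_iterates f H g \<mu>\<^sub>f L\<^sub>h xstar ustar \<gamma> x z u
      using r by simp
    have "(\<gamma> (Suc t))\<^sup>2 \<le> (\<gamma> t)\<^sup>2 + \<gamma> t * slack t / (2 * \<beta>)\<^sup>2" for t
    proof -
      have "\<gamma> (Suc t) \<le> \<gamma>in (Suc t)" using r by simp
      also have "\<dots> \<le> sqrt ((\<gamma> t)\<^sup>2 + \<gamma> t * slack t * (2 * \<beta>) powi (-2))"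
        using v2 by (simp add: atos_run_def variant2_def slack_def)
      also have "\<dots> = sqrt ((\<gamma> t)\<^sup>2 + \<gamma> t * slack t / (2 * \<beta>)\<^sup>2)"
      proof -
        have "(2 * \<beta>) powi (-2) = inverse ((2 * \<beta>)\<^sup>2)"
          by (subst power_int_minus) (simp only: power_int_numeral)
        then show ?thesis by (simp only: divide_inverse)
      qed
      finally have "(\<gamma> (Suc t))\<^sup>2 \<le> (sqrt ((\<gamma> t)\<^sup>2 + \<gamma> t * slack t / (2 * \<beta>)\<^sup>2))\<^sup>2"
        using \<gamma>_pos[of "Suc t"] by (intro power_mono) auto
      then show ?thesis
        using \<gamma>_pos[of t] slack_nonneg[of t] by simp
    qed
    moreover have "\<beta>-lipschitz_on UNIV H"
      using \<beta>(2) by (simp add: lipschitz_efun_def H_def[abs_def])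
    ultimately show "(norm (x (Suc t) - xstar))\<^sup>2 \<le> (1 - min \<rho> (min \<xi> (1 / 2))) ^ (t + 1) * E\<^sub>0"
      unfolding \<rho>_def \<xi>_def E\<^sub>0_def
      using r \<beta>(1) by (intro rate_growing_steps) auto
  qed
qed

end
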